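(* Let $t\ge 1$ be an integer and let $g_0^t$ be the ordinary generating function, with respect to length, of nonempty GDAP all of whose vertices have ordinate between $0$ and $t$ (inclusive). Then $g_0^t=\dfrac{N_{t+1}^t}{D_t}$, where $$N_{t+1}^t=\frac{2^{t+2}x^{t+3}(-1)^t}{W(x^2-x-1)^2-W^3}\left(\frac{1}{(x^2-x-1+W)^t}-\frac{1}{(x^2-x-1-W)^t}\right),\qquad W=\sqrt{x^4-2x^3-x^2-2x+1},$$ and $(D_t)_{t\ge 0}$ is the sequence of polynomials in $x$ defined by $D_0=1$, $D_1=1-x^2$ and $D_{t+2}+(x^2-x-1)D_{t+1}+xD_t=0$ for $t\ge 0$.
   Context: A grand Dyck path with air pockets (GDAP) is a lattice path in $\mathbb{Z}^2$ starting at $(0,0)$ and ending on the $x$-axis, consisting of up-steps $U=(1,1)$ and down-steps $D_k=(1,-k)$ with $k\ge 1$, such that no two down-steps are consecutive; the empty path is a GDAP. The length of a path is its number of steps. $W$ denotes the formal power series square root with constant term $1$; the expression for $N_{t+1}^t$ simplifies to a polynomial in $x$. *)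

theory Defs
  imports
    "HOL-Computational_Algebra.Computational_Algebra"
    "HOL-Library.Product_Plus"
    Complex_Main
begin

datatype step = U | D nat

fun step_vec :: "step \<Rightarrow> int \<times> int" where
  "step_vec U = (1, 1)"
| "step_vec (D k) = (1, - int k)"

fun is_down :: "step \<Rightarrow> bool" where
  "is_down U = False"
| "is_down (D k) = True"

(* A path starting at the origin is given by its list of steps; its vertices are
   vertex p 0, ..., vertex p (length p). *)
definition vertex :: "step list \<Rightarrow> nat \<Rightarrow> int \<times> int" where
  "vertex p i = sum_list (map step_vec (take i p))"

definition gdap :: "step list \<Rightarrow> bool" where
  "gdap p \<longleftrightarrow>
     (\<forall>k. D k \<in> set p \<longrightarrow> k \<ge> 1) \<and>
     (\<forall>i. Suc i < length p \<longrightarrow> \<not> (is_down (p ! i) \<and> is_down (p ! Suc i))) \<and>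
     snd (vertex p (length p)) = 0"

definition bounded_gdaps :: "nat \<Rightarrow> nat \<Rightarrow> step list set" where
  "bounded_gdaps t n = {p. gdap p \<and> p \<noteq> [] \<and> length p = n \<and>
     (\<forall>i\<le>length p. 0 \<le> snd (vertex p i) \<and> snd (vertex p i) \<le> int t)}"

lemma vertex_Suc: "i < length p \<Longrightarrow> vertex p (Suc i) = vertex p i + step_vec (p ! i)"
  by (simp add: vertex_def take_Suc_conv_app_nth)

(* Finiteness ensures that card in the definition of g0 really counts paths. *)
lemma finite_bounded_gdaps: "finite (bounded_gdaps t n)"
proof (rule finite_subset)
  let ?S = "insert U (D ` {..t})"
  show "bounded_gdaps t n \<subseteq> {p. set p \<subseteq> ?S \<and> length p = n}"
  proof
    fix p assume p: "p \<in> bounded_gdaps t n"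
    have "s \<in> ?S" if s: "s \<in> set p" for s
    proof (cases s)
      case (D k)
      from s obtain i where i: "i < length p" "p ! i = s"
        by (auto simp: in_set_conv_nth)
      have "0 \<le> snd (vertex p (Suc i))" "snd (vertex p i) \<le> int t"
        using p i by (auto simp: bounded_gdaps_def Suc_le_eq)
      then have "k \<le> t" using i D by (simp add: vertex_Suc)
      then show ?thesis using D by simp
    qed simp
    then show "p \<in> {p. set p \<subseteq> ?S \<and> length p = n}"
      using p by (auto simp: bounded_gdaps_def)
  qed
  show "finite {p. set p \<subseteq> ?S \<and> length p = n}"
    by (rule finite_lists_length_eq) simp
qed

definition g0 :: "nat \<Rightarrow> real fps" where
  "g0 t = Abs_fps (\<lambda>n. of_nat (card (bounded_gdaps t n)))"

definition W :: "real fps" where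
  "W = fps_radical root 2 (fps_X ^ 4 - 2 * fps_X ^ 3 - fps_X ^ 2 - 2 * fps_X + 1)"

lemma W_nth_0: "fps_nth W 0 = 1"
  by (simp add: W_def)

lemma W_square: "W ^ 2 = fps_X ^ 4 - 2 * fps_X ^ 3 - fps_X ^ 2 - 2 * fps_X + 1"
  using power_radical[of "fps_X ^ 4 - 2 * fps_X ^ 3 - fps_X ^ 2 - 2 * fps_X + 1 :: real fps" root 1]
  by (simp add: W_def numeral_2_eq_2)

(* The series x^2 - x - 1 + W has constant term 0, so its inverse powers are Laurent
   series; the formula is therefore read in the field of formal Laurent series. *)
definition N :: "nat \<Rightarrow> real fls" where
  "N t = (let x = fls_X; w = fps_to_fls W in
     2 ^ (t + 2) * x ^ (t + 3) * (-1) ^ t / (w * (x ^ 2 - x - 1) ^ 2 - w ^ 3) *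
     (1 / (x ^ 2 - x - 1 + w) ^ t - 1 / (x ^ 2 - x - 1 - w) ^ t))"

fun Dpoly :: "nat \<Rightarrow> real poly" where
  "Dpoly 0 = 1"
| "Dpoly (Suc 0) = 1 - [:0, 1:] ^ 2"
| "Dpoly (Suc (Suc t)) = - ([:0, 1:] ^ 2 - [:0, 1:] - 1) * Dpoly (Suc t) - [:0, 1:] * Dpoly t"

lemma Dpoly_recurrence:
  "Dpoly (t + 2) + ([:0, 1:] ^ 2 - [:0, 1:] - 1) * Dpoly (t + 1) + [:0, 1:] * Dpoly t = 0"
  by (simp add: ring_distribs)

end

theory Submission
  imports Defs
begin

text \<open>
  Sort the bounded paths by the ordinate \<open>j\<close> of their last vertex and by whether they end with a
  down-step (series \<open>G\<^sub>j\<close>) or not (series \<open>F\<^sub>j\<close>). Removing the last step gives \<open>F\<^sub>0 = 1\<close>,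
  \<open>F\<^sub>j\<^sub>+\<^sub>1 = x (F\<^sub>j + G\<^sub>j)\<close> and \<open>G\<^sub>j = x (F\<^sub>j\<^sub>+\<^sub>1 + \<dots> + F\<^sub>t)\<close>, and eliminating \<open>F\<close> yields the recurrence
  \<open>G\<^sub>j\<^sub>+\<^sub>2 + (x\<^sup>2 - x - 1) G\<^sub>j\<^sub>+\<^sub>1 + x G\<^sub>j = 0\<close>, which the \<open>D\<^sub>j\<close> satisfy by definition. The \<open>N\<^sub>j\<close> satisfy it too, because
  \<open>W\<^sup>2 = (x\<^sup>2 - x - 1)\<^sup>2 - 4 x\<close> is its discriminant. Comparing two initial values, \<open>G\<^sub>j = D\<^sub>j G\<^sub>0 - N\<^sub>j\<close>;
  the claim is the case \<open>j = t\<close>, where \<open>G\<^sub>t = 0\<close>.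
\<close>

section \<open>Paths in the strip and their last step\<close>

definition height :: "step list \<Rightarrow> int" where
  "height p = snd (vertex p (length p))"

text \<open>The empty path is counted on the side of the up-steps, where it supplies
  \<open>F_0 = 1\<close>.\<close>

definition ends_down :: "step list \<Rightarrow> bool" where
  "ends_down p \<longleftrightarrow> p \<noteq> [] \<and> is_down (last p)"

text \<open>Dropping the return to the axis makes the class closed under removal of the last
  step.\<close>

definition bounded_path :: "nat \<Rightarrow> step list \<Rightarrow> bool" where
  "bounded_path t p \<longleftrightarrow>
     (\<forall>k. D k \<in> set p \<longrightarrow> k \<ge> 1) \<and>
     (\<forall>i. Suc i < length p \<longrightarrow> \<not> (is_down (p ! i) \<and> is_down (p ! Suc i))) \<and>
     (\<forall>i\<le>length p. 0 \<le> snd (vertex p i) \<and> snd (vertex p i) \<le> int t)"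

lemma height_Nil [simp]: "height [] = 0"
  by (simp add: height_def vertex_def)

lemma height_snoc [simp]: "height (p @ [s]) = height p + snd (step_vec s)"
  by (simp add: height_def vertex_def)

lemma ends_down_Nil [simp]: "\<not> ends_down []"
  by (simp add: ends_down_def)

lemma ends_down_snoc [simp]: "ends_down (p @ [s]) \<longleftrightarrow> is_down s"
  by (simp add: ends_down_def)

lemma bounded_path_Nil [simp]: "bounded_path t []"
  by (simp add: bounded_path_def vertex_def)

text \<open>Appending \<open>s\<close> creates a single new adjacent pair, \<open>last p\<close> and
  \<open>s\<close>, and none if \<open>p\<close> is empty.\<close>

lemma no_consecutive_snoc:
  "(\<forall>i. Suc i < length (p @ [s]) \<longrightarrow> \<not> (is_down ((p @ [s]) ! i) \<and> is_down ((p @ [s]) ! Suc i)))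
   \<longleftrightarrow> (\<forall>i. Suc i < length p \<longrightarrow> \<not> (is_down (p ! i) \<and> is_down (p ! Suc i))) \<and>
       \<not> (ends_down p \<and> is_down s)" (is "?L \<longleftrightarrow> ?R")
proof
  assume L: ?L
  have "\<not> (ends_down p \<and> is_down s)"
  proof (cases "p = []")
    case False
    then have "Suc (length p - 1) < length (p @ [s])" by simp
    from L[rule_format, OF this] False show ?thesis
      by (simp add: ends_down_def nth_append last_conv_nth)
  qed simp
  moreover have "\<not> (is_down (p ! i) \<and> is_down (p ! Suc i))" if "Suc i < length p" for i
    using L[rule_format, of i] that by (simp add: nth_append)
  ultimately show ?R by blast
next
  assume R: ?R
  show ?L
  proof (intro allI impI)
    fix i assume i: "Suc i < length (p @ [s])"
    show "\<not> (is_down ((p @ [s]) ! i) \<and> is_down ((p @ [s]) ! Suc i))"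
    proof (cases "Suc i < length p")
      case True
      with R show ?thesis by (simp add: nth_append)
    next
      case False
      with i have "length p = Suc i" by simp
      moreover from this have "p \<noteq> []" by auto
      ultimately show ?thesis using R by (simp add: nth_append ends_down_def last_conv_nth)
    qed
  qed
qed

text \<open>The vertices of \<open>p\<close> do not move, so only the new step and the new endpoint
  have to be checked.\<close>

lemma bounded_path_snoc:
  "bounded_path t (p @ [s]) \<longleftrightarrow>
     bounded_path t p \<and> (is_down s \<longrightarrow> s \<noteq> D 0 \<and> \<not> ends_down p) \<and>
     0 \<le> height (p @ [s]) \<and> height (p @ [s]) \<le> int t"
proof -
  have vertex: "vertex (p @ [s]) i = vertex p i" if "i \<le> length p" for i
    using that by (simp add: vertex_def)
  have bounds: "(\<forall>i\<le>length (p @ [s]). 0 \<le> snd (vertex (p @ [s]) i) \<and> snd (vertex (p @ [s]) i) \<le> int t) \<longleftrightarrow>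
      (\<forall>i\<le>length p. 0 \<le> snd (vertex p i) \<and> snd (vertex p i) \<le> int t) \<and>
      0 \<le> height (p @ [s]) \<and> height (p @ [s]) \<le> int t"
    by (auto simp: le_Suc_eq vertex height_def simp del: height_snoc)
  have steps: "(\<forall>k. D k \<in> set (p @ [s]) \<longrightarrow> k \<ge> 1) \<longleftrightarrow>
      (\<forall>k. D k \<in> set p \<longrightarrow> k \<ge> 1) \<and> (is_down s \<longrightarrow> s \<noteq> D 0)"
    by (cases s) auto
  show ?thesis
    unfolding bounded_path_def no_consecutive_snoc bounds steps by argo
qed

lemma bounded_path_height: "bounded_path t p \<Longrightarrow> 0 \<le> height p \<and> height p \<le> int t"
  by (simp add: bounded_path_def height_def)

lemma bounded_gdaps_iff:
  "p \<in> bounded_gdaps t n \<longleftrightarrow> bounded_path t p \<and> p \<noteq> [] \<and> length p = n \<and> height p = 0"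
  by (auto simp: bounded_gdaps_def gdap_def bounded_path_def height_def)

section \<open>Decomposition by the last step, and cardinalities\<close>

definition up_paths :: "nat \<Rightarrow> nat \<Rightarrow> nat \<Rightarrow> step list set" where
  "up_paths t j n = {p. bounded_path t p \<and> length p = n \<and> height p = int j \<and> \<not> ends_down p}"

definition down_paths :: "nat \<Rightarrow> nat \<Rightarrow> nat \<Rightarrow> step list set" where
  "down_paths t j n = {p. bounded_path t p \<and> length p = n \<and> height p = int j \<and> ends_down p}"

text \<open>A down-step of size \<open>k\<close> needs a starting height between \<open>k\<close>
  and \<open>t\<close>. The resulting finite alphabet gives the finiteness behind the
  counting.\<close>

lemma bounded_path_steps:
  assumes "bounded_path t p"
  shows "set p \<subseteq> insert U (D ` {..t})"
  using assms
proof (induction p rule: rev_induct)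
  case (snoc s p)
  then show ?case
    using bounded_path_height[of t p] by (cases s) (auto simp: bounded_path_snoc)
qed simp

lemma finite_bounded_paths: "finite {p. bounded_path t p \<and> length p = n}"
  by (rule finite_subset[OF _ finite_lists_length_eq[of "insert U (D ` {..t})" n]])
     (auto dest: bounded_path_steps)

lemma finite_up_paths [simp]: "finite (up_paths t j n)"
  by (rule finite_subset[OF _ finite_bounded_paths[of t n]]) (auto simp: up_paths_def)

lemma finite_down_paths [simp]: "finite (down_paths t j n)"
  by (rule finite_subset[OF _ finite_bounded_paths[of t n]]) (auto simp: down_paths_def)

lemma up_paths_0: "up_paths t j 0 = (if j = 0 then {[]} else {})"
  by (auto simp: up_paths_def)

lemma down_paths_0: "down_paths t j 0 = {}"
  by (auto simp: down_paths_def)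

text \<open>A final up-step onto the axis would start at height -1.\<close>

lemma up_paths_0_Suc: "up_paths t 0 (Suc n) = {}"
proof -
  have "p \<notin> up_paths t 0 (Suc n)" for p
  proof (cases p rule: rev_cases)
    case (snoc q s)
    then show ?thesis
      using bounded_path_height[of t q] by (cases s) (auto simp: up_paths_def bounded_path_snoc)
  qed (simp add: up_paths_def)
  then show ?thesis by blast
qed

lemma up_paths_Suc_Suc:
  assumes "j < t"
  shows "up_paths t (Suc j) (Suc n) = (\<lambda>p. p @ [U]) ` (up_paths t j n \<union> down_paths t j n)"
proof (rule set_eqI)
  fix p
  show "p \<in> up_paths t (Suc j) (Suc n) \<longleftrightarrow>
      p \<in> (\<lambda>p. p @ [U]) ` (up_paths t j n \<union> down_paths t j n)"
  proof (cases p rule: rev_cases)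
    case (snoc q s)
    then show ?thesis
      using assms by (cases s) (auto simp: up_paths_def down_paths_def bounded_path_snoc)
  qed (auto simp: up_paths_def)
qed

text \<open>The starting height \<open>m > j\<close> of the last step fixes its size, and the step
  before it cannot be a down-step.\<close>

lemma down_paths_Suc:
  "down_paths t j (Suc n) = (\<Union>m\<in>{j<..t}. (\<lambda>p. p @ [D (m - j)]) ` up_paths t m n)"
proof (rule set_eqI)
  fix p
  show "p \<in> down_paths t j (Suc n) \<longleftrightarrow>
      p \<in> (\<Union>m\<in>{j<..t}. (\<lambda>p. p @ [D (m - j)]) ` up_paths t m n)"
  proof (cases p rule: rev_cases)
    case (snoc q s)
    show ?thesis
    proof (cases s)
      case (D k)
      show ?thesis
      proof
        assume "p \<in> down_paths t j (Suc n)"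
        with snoc D have q: "bounded_path t q" "length q = n" "height q = int (j + k)"
          "\<not> ends_down q" "k > 0"
          by (auto simp: down_paths_def bounded_path_snoc)
        then have "j + k \<le> t" using bounded_path_height by force
        moreover have "q \<in> up_paths t (j + k) n" using q by (simp add: up_paths_def)
        ultimately have "j + k \<in> {j<..t}" "p \<in> (\<lambda>p. p @ [D (j + k - j)]) ` up_paths t (j + k) n"
          using snoc D \<open>k > 0\<close> by auto
        then show "p \<in> (\<Union>m\<in>{j<..t}. (\<lambda>p. p @ [D (m - j)]) ` up_paths t m n)" by blast
      next
        assume "p \<in> (\<Union>m\<in>{j<..t}. (\<lambda>p. p @ [D (m - j)]) ` up_paths t m n)"
        then show "p \<in> down_paths t j (Suc n)"
          by (auto simp: up_paths_def down_paths_def bounded_path_snoc of_nat_diff)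
      qed
    qed (use snoc in \<open>auto simp: down_paths_def\<close>)
  qed (auto simp: down_paths_def)
qed

text \<open>A nonempty path can return to the axis only by a down-step, so \<open>g0 t\<close> is
  the series \<open>G_0\<close>.\<close>

lemma bounded_gdaps_eq_down_paths: "bounded_gdaps t n = down_paths t 0 n"
proof -
  have "ends_down p" if "p \<in> bounded_gdaps t n" for p
  proof (rule ccontr)
    assume "\<not> ends_down p"
    with that have "p \<in> up_paths t 0 n" "n \<noteq> 0"
      by (auto simp: bounded_gdaps_iff up_paths_def)
    then show False by (cases n) (auto simp: up_paths_0_Suc)
  qed
  then show ?thesis
    by (auto simp: bounded_gdaps_iff down_paths_def)
qed

lemma card_up_paths_Suc_Suc:
  assumes "j < t"
  shows "card (up_paths t (Suc j) (Suc n)) = card (up_paths t j n) + card (down_paths t j n)"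
proof -
  have "card (up_paths t (Suc j) (Suc n)) = card (up_paths t j n \<union> down_paths t j n)"
    unfolding up_paths_Suc_Suc[OF assms] by (rule card_image) (simp add: inj_on_def)
  also have "\<dots> = card (up_paths t j n) + card (down_paths t j n)"
    by (rule card_Un_disjoint[OF finite_up_paths finite_down_paths]) (auto simp: up_paths_def down_paths_def)
  finally show ?thesis .
qed

lemma card_down_paths_Suc:
  "card (down_paths t j (Suc n)) = (\<Sum>m\<in>{j<..t}. card (up_paths t m n))"
proof -
  have "card (down_paths t j (Suc n)) =
      (\<Sum>m\<in>{j<..t}. card ((\<lambda>p. p @ [D (m - j)]) ` up_paths t m n))"
    \<comment> \<open>Images for different \<open>m\<close> are disjoint, since their last steps
      \<open>D (m - j)\<close> differ.\<close>
    unfolding down_paths_Suc by (rule card_UN_disjoint) auto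
  also have "\<dots> = (\<Sum>m\<in>{j<..t}. card (up_paths t m n))"
    by (intro sum.cong refl card_image) (simp add: inj_on_def)
  finally show ?thesis .
qed

section \<open>The generating functions F_j and G_j\<close>

definition up_gf :: "nat \<Rightarrow> nat \<Rightarrow> real fps" where
  "up_gf t j = Abs_fps (\<lambda>n. of_nat (card (up_paths t j n)))"

definition down_gf :: "nat \<Rightarrow> nat \<Rightarrow> real fps" where
  "down_gf t j = Abs_fps (\<lambda>n. of_nat (card (down_paths t j n)))"

lemma up_gf_0: "up_gf t 0 = 1"
proof (rule fps_ext)
  fix n show "fps_nth (up_gf t 0) n = fps_nth 1 n"
    by (cases n) (simp_all add: up_gf_def up_paths_0 up_paths_0_Suc)
qed

lemma up_gf_Suc:
  assumes "j < t"
  shows "up_gf t (Suc j) = fps_X * (up_gf t j + down_gf t j)"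
proof (rule fps_ext)
  fix n show "fps_nth (up_gf t (Suc j)) n = fps_nth (fps_X * (up_gf t j + down_gf t j)) n"
    by (cases n) (simp_all add: up_gf_def down_gf_def up_paths_0 card_up_paths_Suc_Suc assms)
qed

lemma down_gf_eq: "down_gf t j = fps_X * (\<Sum>m\<in>{j<..t}. up_gf t m)"
proof (rule fps_ext)
  fix n show "fps_nth (down_gf t j) n = fps_nth (fps_X * (\<Sum>m\<in>{j<..t}. up_gf t m)) n"
    by (cases n)
      (simp_all add: up_gf_def down_gf_def down_paths_0 card_down_paths_Suc fps_sum_nth)
qed

text \<open>No down-step ends at the top of the strip; this boundary value determines
  \<open>G_0\<close>.\<close>

lemma down_gf_top: "down_gf t t = 0"
  by (simp add: down_gf_eq)

text \<open>Neighbouring sums in \<open>down_gf_eq\<close> differ in one term, which makes the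
  relation local.\<close>

lemma down_gf_Suc:
  assumes "j < t"
  shows "down_gf t (Suc j) = down_gf t j - fps_X * up_gf t (Suc j)"
proof -
  have "{j<..t} = insert (Suc j) {Suc j<..t}" using assms by auto
  then show ?thesis by (simp add: down_gf_eq algebra_simps)
qed

text \<open>The inhomogeneous term comes from the empty path, through
  \<open>F_1 = x (1 + G_0)\<close>.\<close>

lemma down_gf_1:
  assumes "1 \<le> t"
  shows "down_gf t 1 = (1 - fps_X ^ 2) * down_gf t 0 - fps_X ^ 2"
  using assms by (simp add: down_gf_Suc up_gf_Suc up_gf_0 algebra_simps power2_eq_square)

lemma down_gf_recurrence:
  assumes "Suc j < t"
  shows "down_gf t (Suc (Suc j)) =
    - (fps_X ^ 2 - fps_X - 1) * down_gf t (Suc j) - fps_X * down_gf t j"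
proof -
  have "down_gf t (Suc (Suc j)) =
      down_gf t (Suc j) - fps_X ^ 2 * down_gf t (Suc j) - fps_X * (fps_X * up_gf t (Suc j))"
    using assms
    by (simp add: down_gf_Suc[of "Suc j"] up_gf_Suc[of "Suc j"] algebra_simps power2_eq_square)
  \<comment> \<open>Reading \<open>down_gf_Suc\<close> backwards eliminates the remaining F.\<close>
  moreover have "fps_X * up_gf t (Suc j) = down_gf t j - down_gf t (Suc j)"
    using assms by (simp add: down_gf_Suc[of j])
  ultimately show ?thesis by (simp add: algebra_simps)
qed

section \<open>Binet form and recurrence of N\<close>

lemma W_fls_square: "fps_to_fls W ^ 2 = (fls_X ^ 2 - fls_X - 1) ^ 2 - 4 * fls_X"
proof -
  have "W ^ 2 = (fps_X ^ 2 - fps_X - 1) ^ 2 - 4 * fps_X"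
    unfolding W_square by (simp add: algebra_simps power2_eq_square power4_eq_xxxx power3_eq_cube)
  then have "fps_to_fls (W ^ 2) = fps_to_fls ((fps_X ^ 2 - fps_X - 1) ^ 2 - 4 * fps_X)"
    by simp
  then show ?thesis
    by (simp add: fps_to_fls_power fls_times_fps_to_fls)
qed

lemma W_fls_nonzero: "fps_to_fls W \<noteq> 0"
  using W_nth_0 by auto

text \<open>Since \<open>(a + W) (a - W) = 4 x\<close> for \<open>a = x\<^sup>2 - x - 1\<close>, the inverse powers become powers.\<close>

lemma N_eq:
  fixes a :: "real fls"
  defines "a \<equiv> fls_X ^ 2 - fls_X - 1" and "w \<equiv> fps_to_fls W"
  shows "N t = fls_X ^ 2 / w * (((w - a) / 2) ^ t - (- (w + a) / 2) ^ t)"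
proof -
  let ?x = "fls_X :: real fls"
  have w2: "w ^ 2 = a ^ 2 - 4 * ?x" and w0: "w \<noteq> 0"
    using W_fls_square W_fls_nonzero by (simp_all add: a_def w_def)
  have prod: "(a + w) * (a - w) = 4 * ?x"
    using w2 by (simp add: algebra_simps power2_eq_square)
  then have nz: "a + w \<noteq> 0" "a - w \<noteq> 0" by auto
  have den: "w * a ^ 2 - w ^ 3 = 4 * ?x * w"
    using w2 by algebra
  have inv1: "1 / (a + w) = (a - w) / (4 * ?x)" and inv2: "1 / (a - w) = (a + w) / (4 * ?x)"
    using prod nz by (simp_all add: field_simps)
  have "N t = 2 ^ (t + 2) * ?x ^ (t + 3) * (-1) ^ t / (4 * ?x * w) *
      ((1 / (a + w)) ^ t - (1 / (a - w)) ^ t)"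
    unfolding N_def Let_def power_one_over den[symmetric] by (simp add: a_def w_def)
  \<comment> \<open>Cancelling \<open>4 * ?x\<close> leaves the \<open>t\<close>-th power of
    \<open>- 2 * ?x\<close>, to be absorbed into the two inverse powers.\<close>
  also have "\<dots> = ?x ^ 2 / w * ((- 2 * ?x) ^ t * ((1 / (a + w)) ^ t - (1 / (a - w)) ^ t))"
    using w0 by (simp add: field_simps power_add power2_eq_square power3_eq_cube power_minus[of "_ * _"]
      power_mult_distrib)
  also have "\<dots> = ?x ^ 2 / w *
      ((- 2 * ?x * (1 / (a + w))) ^ t - (- 2 * ?x * (1 / (a - w))) ^ t)"
    by (simp only: power_mult_distrib right_diff_distrib)
  also have "- 2 * ?x * (1 / (a + w)) = (w - a) / 2"
    unfolding inv1 by (simp add: field_simps)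
  also have "- 2 * ?x * (1 / (a - w)) = - (w + a) / 2"
    unfolding inv2 by (simp add: field_simps)
  finally show ?thesis .
qed

lemma N_0: "N 0 = 0"
  by (simp add: N_def)

text \<open>The two bases in \<open>N_eq\<close> differ by \<open>w\<close>, which cancels the
  denominator.\<close>

lemma N_1: "N 1 = fls_X ^ 2"
  using W_fls_nonzero by (simp add: N_eq field_simps)

text \<open>By \<open>N_eq\<close>, \<open>N t\<close> is a combination of \<open>t\<close>-th
  powers of the two roots of \<open>r^2 + a r + x\<close>, with coefficients independent of
  \<open>t\<close>.\<close>

lemma N_recurrence:
  "N (Suc (Suc t)) = - (fls_X ^ 2 - fls_X - 1) * N (Suc t) - fls_X * N t"
proof -
  define a w where "a = (fls_X ^ 2 - fls_X - 1 :: real fls)" and "w = fps_to_fls W"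
  have root: "r ^ Suc (Suc t) = - a * r ^ Suc t - fls_X * r ^ t"
    if "r = (w - a) / 2 \<or> r = - (w + a) / 2" for r
  proof -
    \<comment> \<open>Completing the square: squaring removes the sign and yields the characteristic
      equation for both roots at once.\<close>
    have "2 * r + a = w \<or> 2 * r + a = - w"
      using that by (auto simp: mult.commute[of 2])
    then have "(2 * r + a) ^ 2 = a ^ 2 - 4 * fls_X"
      using W_fls_square[folded a_def w_def] by auto
    then have "4 * r ^ 2 = 4 * (- a * r - fls_X)" by algebra
    then have "r ^ 2 = - a * r - fls_X" by (subst (asm) mult_cancel_left) simp
    then have "r ^ 2 * r ^ t = (- a * r - fls_X) * r ^ t" by simp
    then show ?thesis by (simp add: algebra_simps power2_eq_square)
  qed
  show ?thesis
    unfolding N_eq a_def[symmetric] w_def[symmetric] root[OF disjI1[OF refl]] root[OF disjI2[OF refl]]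
    by (simp only: algebra_simps)
qed

section \<open>The polynomials D_j and the comparison\<close>

lemma fps_of_Dpoly_0: "fps_of_poly (Dpoly 0) = 1"
  by simp

lemma fps_of_Dpoly_1: "fps_of_poly (Dpoly (Suc 0)) = 1 - fps_X ^ 2"
  by (simp add: fps_of_poly_diff fps_of_poly_power fps_of_poly_pCons)

lemma fps_of_Dpoly_recurrence:
  "fps_of_poly (Dpoly (Suc (Suc t))) =
    - (fps_X ^ 2 - fps_X - 1) * fps_of_poly (Dpoly (Suc t)) - fps_X * fps_of_poly (Dpoly t)"
  by (simp add: fps_of_poly_diff fps_of_poly_power fps_of_poly_pCons fps_of_poly_mult fps_of_poly_uminus)

text \<open>At \<open>x = 0\<close> the recurrence reads \<open>D_(t+2) = D_(t+1)\<close>. Hence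
  \<open>D_t\<close> is nonzero and may be divided by.\<close>

lemma fps_of_Dpoly_nth_0: "fps_nth (fps_of_poly (Dpoly t)) 0 = 1"
proof (induction t rule: Dpoly.induct)
  case (3 t)
  then show ?case unfolding fps_of_Dpoly_recurrence by simp
qed (simp_all add: fps_of_Dpoly_0 fps_of_Dpoly_1 del: Dpoly.simps)

text \<open>Both sides obey one linear recurrence up to index \<open>t\<close> and agree at 0 and 1,
  where \<open>N\<close> absorbs the inhomogeneous \<open>x^2\<close> of
  \<open>down_gf_1\<close>.\<close>

lemma down_gf_Dpoly_N:
  assumes "j \<le> t"
  shows "fps_to_fls (down_gf t j) =
    fps_to_fls (fps_of_poly (Dpoly j)) * fps_to_fls (down_gf t 0) - N j"
  using assms
proof (induction j rule: Dpoly.induct)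
  case 1
  then show ?case by (simp add: N_0)
next
  case 2
  then show ?case
    unfolding fps_of_Dpoly_1 using down_gf_1[of t] N_1
    by (simp add: fls_times_fps_to_fls fps_to_fls_power)
next
  case (3 j)
  let ?d = "\<lambda>i. fps_to_fls (fps_of_poly (Dpoly i))" and ?g = "\<lambda>i. fps_to_fls (down_gf t i)"
  let ?c = "- (fls_X ^ 2 - fls_X - 1 :: real fls)"
  have d: "?d (Suc (Suc j)) = ?c * ?d (Suc j) - fls_X * ?d j"
    unfolding fps_of_Dpoly_recurrence
    by (simp add: fls_times_fps_to_fls fps_to_fls_power)
  have "?g (Suc (Suc j)) = ?c * ?g (Suc j) - fls_X * ?g j"
    using 3 by (simp add: down_gf_recurrence fls_times_fps_to_fls fps_to_fls_power)
  also have "\<dots> = ?c * (?d (Suc j) * ?g 0 - N (Suc j)) - fls_X * (?d j * ?g 0 - N j)"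
    using 3 by simp
  also have "\<dots> = ?d (Suc (Suc j)) * ?g 0 - N (Suc (Suc j))"
    unfolding d N_recurrence by (simp only: algebra_simps)
  finally show ?case .
qed

theorem theorem4:
  fixes t :: nat
  assumes "t \<ge> 1"
  shows "fps_to_fls (g0 t) = N t / fps_to_fls (fps_of_poly (Dpoly t))"
proof -
  have "g0 t = down_gf t 0"
    by (simp add: g0_def down_gf_def bounded_gdaps_eq_down_paths)
  moreover have "fps_of_poly (Dpoly t) \<noteq> 0"
    using fps_of_Dpoly_nth_0[of t] by auto
  ultimately show ?thesis
    using down_gf_Dpoly_N[of t t] by (simp add: down_gf_top field_simps)
qed

end
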